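(* Let $0<q<1$, $m\in\mathbb{N}_0$ and $\alpha\ge 0$. Then, for every $n\in\mathbb{N}$ and $x\in[0,1]$, $$S_n^{q,\alpha}(e_{m+1};x)=\frac{x}{[n]_q^{\,m}}\sum_{s=0}^{m}\binom{m}{s}q^{s}[n-1]_q^{\,s}\,S_{n-1}^{q,\frac{q\alpha}{1+\alpha}}\left(e_s;\frac{x+\alpha}{1+\alpha}\right).$$
   Context: For $i\in\mathbb{N}_0$, $[i]_q=1+q+\cdots+q^{i-1}$, $[0]_q=0$; $[i]_q!=[1]_q\cdots[i]_q$, $[0]_q!=1$; and for $0\le k\le n$, $\begin{bmatrix} n\\k\end{bmatrix}_q=\frac{[n]_q!}{[k]_q!\,[n-k]_q!}$. Empty products equal $1$ and $0^0=1$. Write $e_m(t)=t^m$. For $\alpha\ge0$, $n\in\mathbb{N}$, $f\in C[0,1]$ and $x\in[0,1]$, the $q$-Stancu operator is $$S_n^{q,\alpha}(f;x)=\sum_{k=0}^{n}f\left(\frac{[k]_q}{[n]_q}\right)p_{n,k}^{q,\alpha}(x),\qquad p_{n,k}^{q,\alpha}(x)=\begin{bmatrix} n\\k\end{bmatrix}_q\frac{\prod_{i=0}^{k-1}(x+\alpha[i]_q)\prod_{s=0}^{n-1-k}(1-q^sx+\alpha[s]_q)}{\prod_{i=0}^{n-1}(1+\alpha[i]_q)}.$$ For $n=0$ (needed only when the index $n-1$ equals $0$), the convention is $S_0^{q,\alpha}(f;x)=f(0)$. *)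

theory Defs
  imports Complex_Main
begin

definition qint :: "real \<Rightarrow> nat \<Rightarrow> real" where
  "qint q i = (\<Sum>j<i. q ^ j)"

definition qfact :: "real \<Rightarrow> nat \<Rightarrow> real" where
  "qfact q i = (\<Prod>j=1..i. qint q j)"

text \<open>Meaningful only for \<open>k \<le> n\<close>, because of the truncated subtraction.\<close>

definition qbinom :: "real \<Rightarrow> nat \<Rightarrow> nat \<Rightarrow> real" where
  "qbinom q n k = qfact q n / (qfact q k * qfact q (n - k))"

text \<open>Again for \<open>k \<le> n\<close>. A product over \<open>s\<close> from \<open>0\<close> to \<open>n - 1 - k\<close> is written over
  \<open>s < n - k\<close>, so that it is empty when \<open>k = n\<close>.\<close>

definition qstancu_basis :: "real \<Rightarrow> real \<Rightarrow> nat \<Rightarrow> nat \<Rightarrow> real \<Rightarrow> real" where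
  "qstancu_basis q \<alpha> n k x =
     qbinom q n k *
     ((\<Prod>i<k. x + \<alpha> * qint q i) * (\<Prod>s<n - k. 1 - q ^ s * x + \<alpha> * qint q s)) /
     (\<Prod>i<n. 1 + \<alpha> * qint q i)"

text \<open>A function on \<open>[0,1]\<close> is represented by a function on the reals; for \<open>q > 0\<close> only its
  values at the nodes, which lie in \<open>[0,1]\<close>, are used.\<close>

definition qstancu :: "real \<Rightarrow> real \<Rightarrow> nat \<Rightarrow> (real \<Rightarrow> real) \<Rightarrow> real \<Rightarrow> real" where
  "qstancu q \<alpha> n f x =
     (if n = 0 then f 0
      else (\<Sum>k=0..n. f (qint q k / qint q n) * qstancu_basis q \<alpha> n k x))"

definition mono_fun :: "nat \<Rightarrow> real \<Rightarrow> real" where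
  "mono_fun m = (\<lambda>t. t ^ m)"

end

theory Submission
  imports Defs
begin

text \<open>
  The node \<open>[k]/[n]\<close> of the operator absorbs into the \<open>q\<close>-binomial coefficient,
  \<open>([k]/[n]) * binom(n,k) = binom(n-1,k-1)\<close>, which suggests that one factor \<open>t\<close> of
  \<open>t ^ (m+1)\<close> lowers the degree of the basis by one. What makes this work on the whole basis
  function is that the substitution \<open>y = (x+\<alpha>)/(1+\<alpha>)\<close>, \<open>\<beta> = q\<alpha>/(1+\<alpha>)\<close> turns every linear
  factor of the Stancu basis into a linear factor of the same shape, up to the constant \<open>1+\<alpha>\<close>:
  it shifts the index by one in \<open>x + \<alpha>[i]\<close> and in \<open>1 + \<alpha>[i]\<close>, because \<open>[i+1] = 1 + q[i]\<close>, and
  keeps the index in \<open>1 - q^s x + \<alpha>[s]\<close>, because \<open>[s] = 1 - q^s + q[s]\<close>. The numerator and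
  the denominator of the basis function collect the same power of \<open>1+\<alpha>\<close>, and the only factor
  left over is the one with index \<open>0\<close>, namely \<open>x\<close> above and \<open>1\<close> below. Hence
  \<open>([k+1]/[n+1]) p\<^bsub>n+1,k+1\<^esub>(x) = x p\<^bsub>n,k\<^esub>(y)\<close> with parameter \<open>\<beta>\<close> on the right
  (\<open>qstancu_basis_reduction\<close>).

  The term \<open>k = 0\<close> of the operator vanishes on \<open>e\<^bsub>m+1\<^esub>\<close>. In the others the remaining factor
  \<open>([k+1]/[n+1])^m\<close> is \<open>(1 + q[k])^m / [n+1]^m\<close>; expanding it by the binomial theorem and writing
  \<open>[k] = [n] * ([k]/[n])\<close> produces the moments of order at most \<open>m\<close> of the operator of degree \<open>n\<close>.
\<close>

lemma qint_Suc: "qint q (Suc i) = 1 + q * qint q i"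
  unfolding qint_def
  by (simp add: sum.lessThan_Suc_shift sum_distrib_left del: sum.lessThan_Suc)

lemma qint_pos:
  assumes "q > 0"
  shows "qint q (Suc i) > 0"
  unfolding qint_def using assms by (intro sum_pos) auto

lemma qint_geometric: "qint q s = 1 - q ^ s + q * qint q s"
proof -
  have "qint q (Suc s) = qint q s + q ^ s" by (simp add: qint_def)
  then show ?thesis by (simp add: qint_Suc)
qed

lemma qfact_Suc: "qfact q (Suc i) = qint q (Suc i) * qfact q i"
  unfolding qfact_def by simp

lemma qbinom_absorb:
  assumes "q > 0"
  shows "qint q (Suc k) / qint q (Suc n) * qbinom q (Suc n) (Suc k) = qbinom q n k"
  using qint_pos[OF assms, of k] qint_pos[OF assms, of n]
  unfolding qbinom_def by (simp add: qfact_Suc)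

text \<open>The cancellation of the powers of \<open>1 + \<alpha>\<close> uses that the \<open>k\<close> factors of the first product
  and the \<open>n - k\<close> factors of the second one together match the \<open>n\<close> factors of the denominator.\<close>

lemma qstancu_basis_reduction:
  assumes q: "q > 0" and a: "\<alpha> \<ge> 0" and k: "k \<le> n"
  shows "qint q (Suc k) / qint q (Suc n) * qstancu_basis q \<alpha> (Suc n) (Suc k) x =
         x * qstancu_basis q (q * \<alpha> / (1 + \<alpha>)) n k ((x + \<alpha>) / (1 + \<alpha>))"
proof -
  define c where "c = 1 + \<alpha>"
  define b where "b = q * \<alpha> / c"
  define y where "y = (x + \<alpha>) / c"
  have c: "c > 0" using a by (simp add: c_def)
  have cb: "c * b = q * \<alpha>" and cy: "c * y = x + \<alpha>"
    using c by (simp_all add: b_def y_def)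
  have f1: "x + \<alpha> * qint q (Suc i) = c * (y + b * qint q i)" for i
  proof -
    have "c * (y + b * qint q i) = c * y + (c * b) * qint q i" by (simp add: algebra_simps)
    then show ?thesis unfolding cb cy by (simp add: qint_Suc algebra_simps)
  qed
  have f2: "1 - q ^ s * x + \<alpha> * qint q s = c * (1 - q ^ s * y + b * qint q s)" for s
  proof -
    have "c * (1 - q ^ s * y + b * qint q s) = c - q ^ s * (c * y) + (c * b) * qint q s"
      by (simp add: algebra_simps)
    also have "\<dots> = 1 - q ^ s * x + \<alpha> * (1 - q ^ s + q * qint q s)"
      unfolding cb cy by (simp add: c_def algebra_simps)
    finally show ?thesis by (simp flip: qint_geometric)
  qed
  have f3: "1 + \<alpha> * qint q (Suc i) = c * (1 + b * qint q i)" for i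
  proof -
    have "c * (1 + b * qint q i) = c + (c * b) * qint q i" by (simp add: algebra_simps)
    then show ?thesis unfolding cb by (simp add: c_def qint_Suc algebra_simps)
  qed
  have P1: "(\<Prod>i<Suc k. x + \<alpha> * qint q i) = x * (c ^ k * (\<Prod>i<k. y + b * qint q i))"
    unfolding prod.lessThan_Suc_shift f1 prod.distrib by (simp add: qint_def)
  have P2: "(\<Prod>s<n - k. 1 - q ^ s * x + \<alpha> * qint q s) =
            c ^ (n - k) * (\<Prod>s<n - k. 1 - q ^ s * y + b * qint q s)"
    unfolding f2 prod.distrib by simp
  have P3: "(\<Prod>i<Suc n. 1 + \<alpha> * qint q i) = c ^ n * (\<Prod>i<n. 1 + b * qint q i)"
    unfolding prod.lessThan_Suc_shift f3 prod.distrib by (simp add: qint_def)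
  have "qint q (Suc k) / qint q (Suc n) * qstancu_basis q \<alpha> (Suc n) (Suc k) x =
        (qint q (Suc k) / qint q (Suc n) * qbinom q (Suc n) (Suc k)) *
        ((\<Prod>i<Suc k. x + \<alpha> * qint q i) * (\<Prod>s<n - k. 1 - q ^ s * x + \<alpha> * qint q s)) /
        (\<Prod>i<Suc n. 1 + \<alpha> * qint q i)"
    by (simp only: qstancu_basis_def diff_Suc_Suc times_divide_eq_right mult.assoc)
  also have "\<dots> = qbinom q n k *
      (x * (c ^ k * c ^ (n - k)) *
        ((\<Prod>i<k. y + b * qint q i) * (\<Prod>s<n - k. 1 - q ^ s * y + b * qint q s))) /
      (c ^ n * (\<Prod>i<n. 1 + b * qint q i))"
    unfolding P1 P2 P3 qbinom_absorb[OF q] by (simp only: mult_ac)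
  also have "c ^ k * c ^ (n - k) = c ^ n"
    using k by (simp flip: power_add)
  also have "qbinom q n k *
      (x * c ^ n * ((\<Prod>i<k. y + b * qint q i) * (\<Prod>s<n - k. 1 - q ^ s * y + b * qint q s))) /
      (c ^ n * (\<Prod>i<n. 1 + b * qint q i)) = x * qstancu_basis q b n k y"
    using c by (simp add: qstancu_basis_def)
  finally show ?thesis by (simp add: b_def y_def c_def)
qed

text \<open>The separate convention for degree \<open>0\<close> agrees with the general sum, since its only node is
  \<open>0 / 0 = 0\<close> and its only basis function is \<open>1\<close>; so the reduction to degree
  \<open>n - 1\<close> is uniform in \<open>n \<ge> 1\<close>.\<close>

lemma qstancu_eq_sum:
  "qstancu q \<alpha> n f x = (\<Sum>k\<le>n. f (qint q k / qint q n) * qstancu_basis q \<alpha> n k x)"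
  by (simp add: qstancu_def qstancu_basis_def qbinom_def qfact_def qint_def atLeast0AtMost)

text \<open>For \<open>n = 0\<close> this rests on \<open>k = 0\<close> and \<open>0 / 0 = 0\<close>; both sides are then \<open>0 ^ s\<close>.\<close>

lemma qint_power_eq_node:
  assumes "q > 0" and "k \<le> n"
  shows "qint q k ^ s = qint q n ^ s * (qint q k / qint q n) ^ s"
proof (cases n)
  case 0
  then show ?thesis using assms by (simp add: qint_def power_0_left)
next
  case (Suc n')
  then show ?thesis using qint_pos[OF assms(1), of n'] by (simp add: power_divide)
qed

lemma qstancu_moment_recurrence:
  assumes q: "q > 0" and a: "\<alpha> \<ge> 0"
  shows "qstancu q \<alpha> (Suc n) (mono_fun (Suc m)) x =
    x / qint q (Suc n) ^ m *
      (\<Sum>s\<le>m. real (m choose s) * q ^ s * qint q n ^ s *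
         qstancu q (q * \<alpha> / (1 + \<alpha>)) n (mono_fun s) ((x + \<alpha>) / (1 + \<alpha>)))"
proof -
  define N where "N = qint q (Suc n)"
  define B where "B k = qstancu_basis q (q * \<alpha> / (1 + \<alpha>)) n k ((x + \<alpha>) / (1 + \<alpha>))" for k
  have "qstancu q \<alpha> (Suc n) (mono_fun (Suc m)) x =
        (\<Sum>k\<le>n. (qint q (Suc k) / N) ^ Suc m * qstancu_basis q \<alpha> (Suc n) (Suc k) x)"
    unfolding qstancu_eq_sum sum.atMost_Suc_shift mono_fun_def N_def by (simp add: qint_def)
  also have "\<dots> = (\<Sum>k\<le>n. (qint q (Suc k) / N) ^ m * (x * B k))"
  proof (intro sum.cong refl)
    fix k assume "k \<in> {..n}"
    then have "qint q (Suc k) / N * qstancu_basis q \<alpha> (Suc n) (Suc k) x = x * B k"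
      unfolding N_def B_def by (intro qstancu_basis_reduction q a) simp
    then show "(qint q (Suc k) / N) ^ Suc m * qstancu_basis q \<alpha> (Suc n) (Suc k) x =
               (qint q (Suc k) / N) ^ m * (x * B k)"
      by (metis power_Suc2 mult.assoc)
  qed
  also have "\<dots> = x / N ^ m * (\<Sum>k\<le>n. (q * qint q k + 1) ^ m * B k)"
    by (simp add: sum_distrib_left power_divide qint_Suc mult_ac add_ac)
  also have "(\<Sum>k\<le>n. (q * qint q k + 1) ^ m * B k) =
             (\<Sum>k\<le>n. \<Sum>s\<le>m. real (m choose s) * q ^ s * qint q n ^ s *
                              ((qint q k / qint q n) ^ s * B k))"
  proof (intro sum.cong refl)
    fix k assume "k \<in> {..n}"
    then have node: "qint q k ^ s = qint q n ^ s * (qint q k / qint q n) ^ s" for s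
      using qint_power_eq_node[OF q] by simp
    show "(q * qint q k + 1) ^ m * B k =
          (\<Sum>s\<le>m. real (m choose s) * q ^ s * qint q n ^ s * ((qint q k / qint q n) ^ s * B k))"
      unfolding binomial_ring power_mult_distrib node sum_distrib_right
      by (simp add: mult.assoc)
  qed
  also have "\<dots> = (\<Sum>s\<le>m. real (m choose s) * q ^ s * qint q n ^ s *
                              (\<Sum>k\<le>n. (qint q k / qint q n) ^ s * B k))"
    unfolding sum_distrib_left by (rule sum.swap)
  finally show ?thesis
    by (simp add: N_def B_def qstancu_eq_sum mono_fun_def)
qed

theorem theorem2p3:
  fixes q \<alpha> x :: real and m n :: nat
  assumes "0 < q" and "q < 1"
    and "\<alpha> \<ge> 0"
    and "n \<ge> 1"
    and "x \<in> {0..1}"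
  shows "qstancu q \<alpha> n (mono_fun (m + 1)) x =
    x / qint q n ^ m *
      (\<Sum>s=0..m. real (m choose s) * q ^ s * qint q (n - 1) ^ s *
         qstancu q (q * \<alpha> / (1 + \<alpha>)) (n - 1) (mono_fun s) ((x + \<alpha>) / (1 + \<alpha>)))"
  using qstancu_moment_recurrence[OF assms(1,3), of "n - 1" m x] assms(4)
  by (simp add: atLeast0AtMost)

end
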